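(* Let $k$ be a commutative ring and let $(E,\succ,\prec)$ be a dendriform algebra over $k$, with associated associative algebra $E_{ass}$. Then $E$ is an $E_{ass}$-bimodule by $e\cdot x:=e\succ x$ and $x\cdot e:=x\prec e$ ($e\in E_{ass}$, $x\in E$); the identity map $1:E\to E_{ass}$ is a generalized Rota-Baxter operator; and the dendriform algebra corresponding to this generalized Rota-Baxter operator is the original one, $(E,\succ,\prec)$. Hence every dendriform algebra is induced by a generalized Rota-Baxter operator.
   Context: Algebras are not necessarily unital. A dendriform algebra is a $k$-module $E$ with two bilinear operations $\prec,\succ$ such that for all $x,y,z\in E$: $(x\prec y)\prec z=x\prec(y\succ z+y\prec z)$; $(x\succ y)\prec z=x\succ(y\prec z)$; $x\succ(y\succ z)=(x\succ y+x\prec y)\succ z$. The algebra $E_{ass}$ is the module $E$ with the (associative) multiplication $xy:=x\succ y+x\prec y$. For an associative $k$-algebra $\mathcal{A}$ and an $\mathcal{A}$-bimodule $M$, a $k$-linear map $\pi:M\to\mathcal{A}$ is a generalized Rota-Baxter operator if $\pi(m)\pi(n)=\pi(\pi(m)\cdot n+m\cdot\pi(n))$ for all $m,n\in M$. The dendriform algebra corresponding to (induced by) such a $\pi$ is $M$ with $m\succ n:=\pi(m)\cdot n$ and $m\prec n:=m\cdot\pi(n)$. *)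

theory Defs
  imports "HOL-Algebra.Module"
begin

definition linear_map ::
  "('k, 'r) ring_scheme \<Rightarrow> ('k, 'm, 'x) module_scheme \<Rightarrow> ('k, 'n, 'y) module_scheme \<Rightarrow> ('m \<Rightarrow> 'n) \<Rightarrow> bool"
  where "linear_map R M N f \<longleftrightarrow>
    f \<in> carrier M \<rightarrow> carrier N \<and>
    (\<forall>x\<in>carrier M. \<forall>y\<in>carrier M. f (x \<oplus>\<^bsub>M\<^esub> y) = f x \<oplus>\<^bsub>N\<^esub> f y) \<and>
    (\<forall>a\<in>carrier R. \<forall>x\<in>carrier M. f (a \<odot>\<^bsub>M\<^esub> x) = a \<odot>\<^bsub>N\<^esub> f x)"

definition bilinear_map ::
  "('k, 'r) ring_scheme \<Rightarrow> ('k, 'm, 'x) module_scheme \<Rightarrow> ('k, 'n, 'y) module_scheme \<Rightarrow>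
   ('k, 'p, 'z) module_scheme \<Rightarrow> ('m \<Rightarrow> 'n \<Rightarrow> 'p) \<Rightarrow> bool"
  where "bilinear_map R M N P f \<longleftrightarrow>
    (\<forall>x\<in>carrier M. linear_map R N P (f x)) \<and>
    (\<forall>y\<in>carrier N. linear_map R M P (\<lambda>x. f x y))"

(* Algebras need not be unital: the field one of the record is never constrained.
   In the other structures below, which extend the record module as well,
   the inherited fields mult and one are both unconstrained. *)
locale assoc_algebra = module R A
  for R :: "('k, 'r) ring_scheme" (structure) and A :: "('k, 'a, 'x) module_scheme" (structure) +
  assumes mult_bilinear: "bilinear_map R A A A (mult A)"
    and mult_assoc: "\<lbrakk>x \<in> carrier A; y \<in> carrier A; z \<in> carrier A\<rbrakk> \<Longrightarrow>
      (x \<otimes>\<^bsub>A\<^esub> y) \<otimes>\<^bsub>A\<^esub> z = x \<otimes>\<^bsub>A\<^esub> (y \<otimes>\<^bsub>A\<^esub> z)"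

record ('k, 'e) dendriform = "('k, 'e) module" +
  dsucc :: "'e \<Rightarrow> 'e \<Rightarrow> 'e" (infixl \<open>\<succ>\<index>\<close> 70)
  dprec :: "'e \<Rightarrow> 'e \<Rightarrow> 'e" (infixl \<open>\<prec>\<index>\<close> 70)

locale dendriform = module R E
  for R :: "('k, 'r) ring_scheme" (structure) and E :: "('k, 'e, 'x) dendriform_scheme" (structure) +
  assumes succ_bilinear: "bilinear_map R E E E (dsucc E)"
    and prec_bilinear: "bilinear_map R E E E (dprec E)"
    and prec_prec: "\<lbrakk>x \<in> carrier E; y \<in> carrier E; z \<in> carrier E\<rbrakk> \<Longrightarrow>
      (x \<prec>\<^bsub>E\<^esub> y) \<prec>\<^bsub>E\<^esub> z = x \<prec>\<^bsub>E\<^esub> (y \<succ>\<^bsub>E\<^esub> z \<oplus>\<^bsub>E\<^esub> y \<prec>\<^bsub>E\<^esub> z)"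
    and succ_prec: "\<lbrakk>x \<in> carrier E; y \<in> carrier E; z \<in> carrier E\<rbrakk> \<Longrightarrow>
      (x \<succ>\<^bsub>E\<^esub> y) \<prec>\<^bsub>E\<^esub> z = x \<succ>\<^bsub>E\<^esub> (y \<prec>\<^bsub>E\<^esub> z)"
    and succ_succ: "\<lbrakk>x \<in> carrier E; y \<in> carrier E; z \<in> carrier E\<rbrakk> \<Longrightarrow>
      x \<succ>\<^bsub>E\<^esub> (y \<succ>\<^bsub>E\<^esub> z) = (x \<succ>\<^bsub>E\<^esub> y \<oplus>\<^bsub>E\<^esub> x \<prec>\<^bsub>E\<^esub> y) \<succ>\<^bsub>E\<^esub> z"

definition assoc_of :: "('k, 'e) dendriform \<Rightarrow> ('k, 'e) module"
  where "assoc_of E = (module.truncate E)\<lparr>mult := (\<lambda>x y. x \<succ>\<^bsub>E\<^esub> y \<oplus>\<^bsub>E\<^esub> x \<prec>\<^bsub>E\<^esub> y)\<rparr>"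

record ('k, 'a, 'm) bimodule = "('k, 'm) module" +
  lact :: "'a \<Rightarrow> 'm \<Rightarrow> 'm"
  ract :: "'m \<Rightarrow> 'a \<Rightarrow> 'm"

locale bimodule = A: assoc_algebra R A + M: module R M
  for R :: "('k, 'r) ring_scheme" and A :: "('k, 'a, 'x) module_scheme"
    and M :: "('k, 'a, 'm, 'y) bimodule_scheme" +
  assumes lact_bilinear: "bilinear_map R A M M (lact M)"
    and ract_bilinear: "bilinear_map R M A M (ract M)"
    and lact_mult: "\<lbrakk>a \<in> carrier A; b \<in> carrier A; m \<in> carrier M\<rbrakk> \<Longrightarrow>
      lact M (a \<otimes>\<^bsub>A\<^esub> b) m = lact M a (lact M b m)"
    and ract_mult: "\<lbrakk>a \<in> carrier A; b \<in> carrier A; m \<in> carrier M\<rbrakk> \<Longrightarrow>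
      ract M m (a \<otimes>\<^bsub>A\<^esub> b) = ract M (ract M m a) b"
    and lact_ract: "\<lbrakk>a \<in> carrier A; b \<in> carrier A; m \<in> carrier M\<rbrakk> \<Longrightarrow>
      ract M (lact M a m) b = lact M a (ract M m b)"

locale generalized_rota_baxter = bimodule R A M
  for R :: "('k, 'r) ring_scheme" and A :: "('k, 'a, 'x) module_scheme"
    and M :: "('k, 'a, 'm, 'y) bimodule_scheme" and \<pi> :: "'m \<Rightarrow> 'a" +
  assumes linear: "linear_map R M A \<pi>"
    and rota_baxter: "\<lbrakk>m \<in> carrier M; n \<in> carrier M\<rbrakk> \<Longrightarrow>
      \<pi> m \<otimes>\<^bsub>A\<^esub> \<pi> n = \<pi> (lact M (\<pi> m) n \<oplus>\<^bsub>M\<^esub> ract M m (\<pi> n))"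

definition induced_dendriform :: "('k, 'a, 'm) bimodule \<Rightarrow> ('m \<Rightarrow> 'a) \<Rightarrow> ('k, 'm) dendriform"
  where "induced_dendriform M \<pi> = module.extend (module.truncate M)
    (dendriform.fields (\<lambda>m n. lact M (\<pi> m) n) (\<lambda>m n. ract M m (\<pi> n)))"

definition dendriform_bimodule :: "('k, 'e) dendriform \<Rightarrow> ('k, 'e, 'e) bimodule"
  where "dendriform_bimodule E = module.extend (module.truncate E)
    (bimodule.fields (\<lambda>e x. e \<succ>\<^bsub>E\<^esub> x) (\<lambda>x e. x \<prec>\<^bsub>E\<^esub> e))"

end

theory Submission
  imports Defs
begin

text \<open>With xy = x \<succ> y + x \<prec> y, the dendriform axioms read (x \<prec> y) \<prec> z
  = x \<prec> (yz), (x \<succ> y) \<prec> z = x \<succ> (y \<prec> z) and x \<succ> (y \<succ> z) =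
  (xy) \<succ> z. Their sum is associativity (\<open>assoc_algebra_assoc_of\<close>); taken one by
  one they are the three bimodule laws (\<open>bimodule_dendriform_bimodule\<close>). The
  Rota-Baxter identity for \<open>id\<close> is the definition of xy, and twisting the actions by
  \<open>id\<close> leaves them unchanged, which gives back E.\<close>

lemma bilinear_map_iff:
  "bilinear_map R M N P f \<longleftrightarrow>
    (\<forall>x\<in>carrier M. \<forall>y\<in>carrier N. f x y \<in> carrier P) \<and>
    (\<forall>x\<in>carrier M. \<forall>y\<in>carrier N. \<forall>z\<in>carrier N. f x (y \<oplus>\<^bsub>N\<^esub> z) = f x y \<oplus>\<^bsub>P\<^esub> f x z) \<and>
    (\<forall>x\<in>carrier M. \<forall>y\<in>carrier M. \<forall>z\<in>carrier N. f (x \<oplus>\<^bsub>M\<^esub> y) z = f x z \<oplus>\<^bsub>P\<^esub> f y z) \<and>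
    (\<forall>a\<in>carrier R. \<forall>x\<in>carrier M. \<forall>y\<in>carrier N. f x (a \<odot>\<^bsub>N\<^esub> y) = a \<odot>\<^bsub>P\<^esub> f x y) \<and>
    (\<forall>a\<in>carrier R. \<forall>x\<in>carrier M. \<forall>y\<in>carrier N. f (a \<odot>\<^bsub>M\<^esub> x) y = a \<odot>\<^bsub>P\<^esub> f x y)"
  unfolding bilinear_map_def linear_map_def Pi_iff by blast

text \<open>The module axioms see a record only through these four fields, so they pass to the
  records built from \<open>E\<close> with a new product or with added actions.\<close>

lemma module_cong:
  assumes "module R M"
    and "carrier N = carrier M" "add N = add M" "zero N = zero M" "smult N = smult M"
  shows "module R N"
proof -
  interpret M: module R M by (rule assms(1))
  have "abelian_group N"
    by (rule abelian_groupI)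
      (auto simp: assms(2-) M.a_ac intro: M.l_neg M.a_inv_closed)
  then show ?thesis
    by (intro moduleI M.R.is_cring)
      (simp_all add: assms(2-) M.smult_l_distr M.smult_r_distr M.smult_assoc1)
qed

lemma assoc_of_simps [simp]:
  "carrier (assoc_of E) = carrier E"
  "add (assoc_of E) = add E"
  "zero (assoc_of E) = zero E"
  "smult (assoc_of E) = smult E"
  "mult (assoc_of E) x y = x \<succ>\<^bsub>E\<^esub> y \<oplus>\<^bsub>E\<^esub> x \<prec>\<^bsub>E\<^esub> y"
  by (simp_all add: assoc_of_def module.defs)

lemma dendriform_bimodule_simps [simp]:
  "carrier (dendriform_bimodule E) = carrier E"
  "add (dendriform_bimodule E) = add E"
  "zero (dendriform_bimodule E) = zero E"
  "smult (dendriform_bimodule E) = smult E"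
  "lact (dendriform_bimodule E) x y = x \<succ>\<^bsub>E\<^esub> y"
  "ract (dendriform_bimodule E) x y = x \<prec>\<^bsub>E\<^esub> y"
  by (simp_all add: dendriform_bimodule_def module.defs bimodule.defs)

text \<open>This is literal equality of records: truncation also keeps \<open>mult\<close> and
  \<open>one\<close>, and the type of \<open>E\<close> allows no further fields that could be
  lost.\<close>

lemma induced_dendriform_bimodule: "induced_dendriform (dendriform_bimodule E) id = E"
  by (cases E)
    (simp add: induced_dendriform_def dendriform_bimodule_def module.defs bimodule.defs
      dendriform.defs)

lemma assoc_algebra_assoc_of:
  fixes E :: "('k, 'e) dendriform"
  assumes "dendriform R E"
  shows "assoc_algebra R (assoc_of E)"
proof -
  interpret E: dendriform R E by (rule assms)
  note succ = E.succ_bilinear[unfolded bilinear_map_iff]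
    and prec = E.prec_bilinear[unfolded bilinear_map_iff]
  show ?thesis
  proof (intro assoc_algebra.intro assoc_algebra_axioms.intro)
    show "module R (assoc_of E)"
      by (rule module_cong[OF E.module_axioms]) simp_all
    show "bilinear_map R (assoc_of E) (assoc_of E) (assoc_of E) (mult (assoc_of E))"
      using succ prec unfolding bilinear_map_iff
      by (simp add: E.smult_r_distr E.a_ac)
  next
    fix x y z
    assume "x \<in> carrier (assoc_of E)" "y \<in> carrier (assoc_of E)" "z \<in> carrier (assoc_of E)"
    then show "(x \<otimes>\<^bsub>assoc_of E\<^esub> y) \<otimes>\<^bsub>assoc_of E\<^esub> z = x \<otimes>\<^bsub>assoc_of E\<^esub> (y \<otimes>\<^bsub>assoc_of E\<^esub> z)"
      \<comment> \<open>Bilinearity splits (xy)z into (xy) \<succ> z, (x \<succ> y) \<prec> z and (x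
        \<prec> y) \<prec> z; the axioms turn these into x \<succ> (y \<succ> z), x \<succ> (y
        \<prec> z) and x \<prec> (yz), whose sum is x(yz).\<close>
      using succ prec
      by (simp add: E.prec_prec E.succ_prec E.succ_succ E.a_assoc)
  qed
qed

lemma bimodule_dendriform_bimodule:
  fixes E :: "('k, 'e) dendriform"
  assumes "dendriform R E"
  shows "bimodule R (assoc_of E) (dendriform_bimodule E)"
proof -
  interpret E: dendriform R E by (rule assms)
  show ?thesis
  proof (intro bimodule.intro bimodule_axioms.intro)
    show "assoc_algebra R (assoc_of E)"
      by (rule assoc_algebra_assoc_of[OF assms])
    show "module R (dendriform_bimodule E)"
      by (rule module_cong[OF E.module_axioms]) simp_all
    show "bilinear_map R (assoc_of E) (dendriform_bimodule E) (dendriform_bimodule E)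
        (lact (dendriform_bimodule E))"
      using E.succ_bilinear by (simp add: bilinear_map_iff)
    show "bilinear_map R (dendriform_bimodule E) (assoc_of E) (dendriform_bimodule E)
        (ract (dendriform_bimodule E))"
      using E.prec_bilinear by (simp add: bilinear_map_iff)
  \<comment> \<open>\<open>lact_mult\<close> is \<open>succ_succ\<close>, \<open>ract_mult\<close>
    is \<open>prec_prec\<close> and \<open>lact_ract\<close> is \<open>succ_prec\<close>.\<close>
  qed (simp_all add: E.prec_prec E.succ_prec E.succ_succ)
qed

lemma generalized_rota_baxter_id:
  fixes E :: "('k, 'e) dendriform"
  assumes "dendriform R E"
  shows "generalized_rota_baxter R (assoc_of E) (dendriform_bimodule E) id"
  by (intro generalized_rota_baxter.intro generalized_rota_baxter_axioms.intro
      bimodule_dendriform_bimodule assms)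
    (simp_all add: linear_map_def)

theorem mainTheorem6:
  fixes R :: "('k, 'r) ring_scheme" and E :: "('k, 'e) dendriform"
  assumes "cring R" and "dendriform R E"
  shows "bimodule R (assoc_of E) (dendriform_bimodule E) \<and>
    generalized_rota_baxter R (assoc_of E) (dendriform_bimodule E) id \<and>
    induced_dendriform (dendriform_bimodule E) id = E \<and>
    (\<exists>(A :: ('k, 'e) module) (M :: ('k, 'e, 'e) bimodule) \<pi>.
      generalized_rota_baxter R A M \<pi> \<and> induced_dendriform M \<pi> = E)"
  \<comment> \<open>The existential is witnessed by \<open>assoc_of E\<close>,
    \<open>dendriform_bimodule E\<close> and \<open>id\<close>.\<close>
  using bimodule_dendriform_bimodule[OF assms(2)] generalized_rota_baxter_id[OF assms(2)]
    induced_dendriform_bimodule[of E]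
  by blast

end
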